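(* Let $\mathcal B=(\mathbf x_n)_{n=1}^\infty$ be a semi-normalized Markushevich basis of a Banach space $\mathbb X$ over $\mathbb F=\mathbb R$ or $\mathbb C$. Then $\mathcal B$ has the Property (Q$^*$) with constant $\mathcal Q=1$ if and only if $$\Vert f+\varepsilon_n\mathbf x_n\Vert\le\Vert f+\eta_k\mathbf x_k+y\Vert$$ for all $f\in\mathbb X$, all $y\in\mathbb X_f$, all pairs of different indices $n,k\in\mathbb N$ and all scalars $\varepsilon_n,\eta_k\in\mathbb F$ such that $\Vert(\mathbf x_j^*(f))_j\Vert_\infty\le1$, $\operatorname{supp}(f)\cap\operatorname{supp}(y)=\emptyset$, $\operatorname{supp}(f+y)\cap\{n,k\}=\emptyset$ and $\vert\varepsilon_n\vert=\vert\eta_k\vert=1$.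
   Context: Setting. A sequence $\mathcal B=(\mathbf x_n)_{n=1}^\infty$ in a Banach space $\mathbb X$ is a semi-normalized Markushevich basis if: the closed linear span of $(\mathbf x_n)_n$ is $\mathbb X$; there is a unique sequence $(\mathbf x_n^* )_{n=1}^\infty\subset\mathbb X^*$ with $\mathbf x_n^*(\mathbf x_j)=\delta_{n,j}$; the weak$^*$-closed linear span of $(\mathbf x_n^* )_n$ is $\mathbb X^*$; and there are constants $c_1,c_2$ with $0<c_1\le \inf_n\{\Vert \mathbf x_n\Vert,\Vert\mathbf x_n^*\Vert\}\le\sup_n\{\Vert \mathbf x_n\Vert,\Vert\mathbf x_n^*\Vert\}\le c_2<\infty$. Notation. $\operatorname{supp}(f)=\{n\in\mathbb N:\mathbf x_n^*(f)\neq0\}$; $\mathbb X_f$ denotes the subspace of all elements of $\mathbb X$ with finite support; $\Vert(\mathbf x_n^*(f))_n\Vert_\infty=\sup_{n\in\operatorname{supp}(f)}\vert\mathbf x_n^*(f)\vert$ (equal to $0$ if $f=0$). For a finite set $A\subset\mathbb N$ and scalars $\varepsilon=(\varepsilon_n)_{n\in A}$ with $\vert\varepsilon_n\vert=1$ for all $n\in A$ (written $\vert\varepsilon\vert=1$), $\mathbf 1_{\varepsilon A}=\sum_{j\in A}\varepsilon_j\mathbf x_j$. Definition. $\mathcal B$ has the Property (Q$^*$) with constant $\mathcal Q=1$ if $\Vert f+\mathbf 1_{\varepsilon A}\Vert\le\Vert f+y\Vert$ for all $f\in\mathbb X$, $y\in\mathbb X_f$, $A$ and $\varepsilon$ such that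 $\Vert(\mathbf x_n^*(f))_n\Vert_\infty\le1$, $\vert A\vert\le\vert B\vert<\infty$ where $B=\{n\in\operatorname{supp}(y):\vert\mathbf x_n^*(y)\vert=1\}$, $\operatorname{supp}(f)\cap\operatorname{supp}(y)=\emptyset$, $\operatorname{supp}(f+y)\cap A=\emptyset$ and $\vert\varepsilon\vert=1$. *)

theory Defs
  imports "HOL-Analysis.Analysis" "HOL-Library.Function_Algebras"
begin

(* Banach spaces over F = R or C.  The scalar field is a type of class real_normed_field; by the
   Gelfand-Mazur theorem such a field is, up to isometric isomorphism, R or C, and both are
   instances.  The class banach supplies the underlying real Banach space; smul is the
   multiplication by scalars in F, which extends the one by real scalars. *)
locale banach_over = vector_space smul
  for smul :: "'f::real_normed_field \<Rightarrow> 'a::banach \<Rightarrow> 'a" +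
  assumes norm_smul: "norm (smul c v) = norm c * norm v"
    and smul_of_real: "smul (of_real r) v = r *\<^sub>R v"

lemma banach_over_scaleR: "banach_over (scaleR :: real \<Rightarrow> 'a::banach \<Rightarrow> 'a)"
  by unfold_locales (auto simp: scaleR_add_right scaleR_add_left)

lemma banach_over_complex: "banach_over ((*) :: complex \<Rightarrow> complex \<Rightarrow> complex)"
  by unfold_locales (auto simp: algebra_simps norm_mult scaleR_conv_of_real)

(* The dual X*: bounded F-linear functionals. *)
definition dual_space :: "('f::real_normed_field \<Rightarrow> 'a::banach \<Rightarrow> 'a) \<Rightarrow> ('a \<Rightarrow> 'f) set" where
  "dual_space smul = {\<phi>. bounded_linear \<phi> \<and> (\<forall>c v. \<phi> (smul c v) = c * \<phi> v)}"

(* Functions carry the topology of pointwise convergence, which induces the weak* topology on X*. *)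
definition weak_star_topology ::
  "('f::real_normed_field \<Rightarrow> 'a::banach \<Rightarrow> 'a) \<Rightarrow> ('a \<Rightarrow> 'f) topology" where
  "weak_star_topology smul = subtopology euclidean (dual_space smul)"

definition biorthogonal ::
  "('f::real_normed_field \<Rightarrow> 'a::banach \<Rightarrow> 'a) \<Rightarrow> (nat \<Rightarrow> 'a) \<Rightarrow> (nat \<Rightarrow> 'a \<Rightarrow> 'f) \<Rightarrow> bool" where
  "biorthogonal smul x xs \<longleftrightarrow>
     (\<forall>n. xs n \<in> dual_space smul) \<and> (\<forall>n j. xs n (x j) = (if n = j then 1 else 0))"

(* The sequence (x_n^* ); only meaningful if the biorthogonal sequence exists and is unique,
   as is the case for a Markushevich basis. *)
definition coord ::
  "('f::real_normed_field \<Rightarrow> 'a::banach \<Rightarrow> 'a) \<Rightarrow> (nat \<Rightarrow> 'a) \<Rightarrow> nat \<Rightarrow> 'a \<Rightarrow> 'f" where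
  "coord smul x = (THE xs. biorthogonal smul x xs)"

(* Sequences are indexed by nat from 0. *)
definition semi_normalized_markushevich_basis ::
  "('f::real_normed_field \<Rightarrow> 'a::banach \<Rightarrow> 'a) \<Rightarrow> (nat \<Rightarrow> 'a) \<Rightarrow> bool" where
  "semi_normalized_markushevich_basis smul x \<longleftrightarrow>
     closure (module.span smul (range x)) = UNIV \<and>
     (\<exists>!xs. biorthogonal smul x xs) \<and>
     weak_star_topology smul closure_of
       module.span (\<lambda>c \<phi> v. c * \<phi> v) (range (coord smul x)) = dual_space smul \<and>
     (\<exists>c1 c2. 0 < c1 \<and>
        (\<forall>n. c1 \<le> norm (x n) \<and> c1 \<le> onorm (coord smul x n) \<and>
             norm (x n) \<le> c2 \<and> onorm (coord smul x n) \<le> c2))"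

definition supp ::
  "('f::real_normed_field \<Rightarrow> 'a::banach \<Rightarrow> 'a) \<Rightarrow> (nat \<Rightarrow> 'a) \<Rightarrow> 'a \<Rightarrow> nat set" where
  "supp smul x f = {n. coord smul x n f \<noteq> 0}"

(* The subspace X_f. *)
definition finite_support ::
  "('f::real_normed_field \<Rightarrow> 'a::banach \<Rightarrow> 'a) \<Rightarrow> (nat \<Rightarrow> 'a) \<Rightarrow> 'a set" where
  "finite_support smul x = {f. finite (supp smul x f)}"

definition coord_sup ::
  "('f::real_normed_field \<Rightarrow> 'a::banach \<Rightarrow> 'a) \<Rightarrow> (nat \<Rightarrow> 'a) \<Rightarrow> 'a \<Rightarrow> real" where
  "coord_sup smul x f =
     (if f = 0 then 0 else (SUP n\<in>supp smul x f. norm (coord smul x n f)))"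

(* The vector 1_{eps A}. *)
definition signed_indicator ::
  "('f::real_normed_field \<Rightarrow> 'a::banach \<Rightarrow> 'a) \<Rightarrow> (nat \<Rightarrow> 'a) \<Rightarrow> (nat \<Rightarrow> 'f) \<Rightarrow> nat set \<Rightarrow> 'a" where
  "signed_indicator smul x \<epsilon> A = (\<Sum>j\<in>A. smul (\<epsilon> j) (x j))"

(* Property (Q* ) with constant 1. *)
definition property_Q_star_1 ::
  "('f::real_normed_field \<Rightarrow> 'a::banach \<Rightarrow> 'a) \<Rightarrow> (nat \<Rightarrow> 'a) \<Rightarrow> bool" where
  "property_Q_star_1 smul x \<longleftrightarrow>
     (\<forall>f. \<forall>y \<in> finite_support smul x. \<forall>A \<epsilon>.
        let B = {n \<in> supp smul x y. norm (coord smul x n y) = 1} in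
        coord_sup smul x f \<le> 1 \<longrightarrow>
        finite A \<longrightarrow> finite B \<longrightarrow> card A \<le> card B \<longrightarrow>
        supp smul x f \<inter> supp smul x y = {} \<longrightarrow>
        supp smul x (f + y) \<inter> A = {} \<longrightarrow>
        (\<forall>n\<in>A. norm (\<epsilon> n) = 1) \<longrightarrow>
        norm (f + signed_indicator smul x \<epsilon> A) \<le> norm (f + y))"

end

theory Submission
  imports Defs
begin

text \<open>
  Property (Q*) contains the exchange inequality as the case \<open>A = {n}\<close> with \<open>\<eta> x\<^sub>k + y\<close> in place
  of \<open>y\<close>, so only the converse needs an idea. There the set \<open>A\<close> is traded for the unimodular
  entries of \<open>y\<close> one index at a time: if \<open>n \<in> A\<close> and \<open>k \<in> B\<close> with \<open>\<eta> = x\<^sub>k\<^sup>*(y)\<close>, the exchange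
  inequality for the vector \<open>f + \<one>\<^bsub>\<epsilon>(A - {n})\<^esub>\<close> replaces \<open>\<epsilon>\<^sub>n x\<^sub>n\<close> by \<open>\<eta> x\<^sub>k\<close>, and \<open>\<eta> x\<^sub>k\<close> is then moved
  from \<open>y\<close> to \<open>f\<close> (lemma \<open>indicator_le_of_exchange\<close>).

  After the last trade \<open>A\<close> is empty, and what is left to show is \<open>\<parallel>f\<parallel> \<le> \<parallel>f + y\<parallel>\<close> for disjointly
  supported \<open>f\<close> and \<open>y\<close>, where \<open>y\<close> may be small or large. For \<open>f\<close> in the span of the basis
  (lemma \<open>norm_le_add_of_span\<close>) homogeneity allows to assume that the largest coefficient of
  \<open>f = h + \<eta> x\<^sub>k\<close> is attained at \<open>k\<close> and has modulus one. For an index \<open>n\<close> outside all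
  supports, two exchanges, to \<open>n\<close> and back, give
  \<open>\<parallel>h + \<eta> x\<^sub>k\<parallel> \<le> \<parallel>h + x\<^sub>n\<parallel> \<le> \<parallel>h + \<eta> x\<^sub>k + y\<parallel>\<close>.
  A general \<open>f\<close> is reached by density of the span (lemma \<open>norm_le_add_of_disjoint_supp\<close>): the
  projection that erases the finitely many coordinates in \<open>supp y\<close> is continuous, fixes \<open>f\<close> and
  maps the span to itself.
\<close>

section \<open>Coordinate functionals\<close>

locale markushevich_basis = banach_over smul
  for smul :: "'f::real_normed_field \<Rightarrow> 'a::banach \<Rightarrow> 'a" +
  fixes x :: "nat \<Rightarrow> 'a"
  assumes basis: "semi_normalized_markushevich_basis smul x"
begin

abbreviation xs :: "nat \<Rightarrow> 'a \<Rightarrow> 'f"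
  where "xs \<equiv> coord smul x"

abbreviation spt :: "'a \<Rightarrow> nat set"
  where "spt \<equiv> supp smul x"

lemma biorthogonal_coord: "biorthogonal smul x xs"
  using basis theI'[of "biorthogonal smul x"]
  unfolding semi_normalized_markushevich_basis_def coord_def by blast

lemma bounded_linear_coord: "bounded_linear (xs n)"
  using biorthogonal_coord by (auto simp: biorthogonal_def dual_space_def)

lemma coord_smul [simp]: "xs n (smul c v) = c * xs n v"
  using biorthogonal_coord by (auto simp: biorthogonal_def dual_space_def)

lemma coord_basis [simp]: "xs n (x j) = (if n = j then 1 else 0)"
  using biorthogonal_coord by (auto simp: biorthogonal_def)

lemma coord_add [simp]: "xs n (u + v) = xs n u + xs n v"
  by (rule linear_add[OF bounded_linear.linear[OF bounded_linear_coord]])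

lemma coord_diff [simp]: "xs n (u - v) = xs n u - xs n v"
  by (rule linear_diff[OF bounded_linear.linear[OF bounded_linear_coord]])

lemma coord_zero [simp]: "xs n 0 = 0"
  by (rule linear_0[OF bounded_linear.linear[OF bounded_linear_coord]])

lemma coord_sum: "xs n (sum g I) = (\<Sum>i\<in>I. xs n (g i))"
  by (rule linear_sum[OF bounded_linear.linear[OF bounded_linear_coord]])

lemma coord_sum_basis:
  assumes "finite I"
  shows "xs n (\<Sum>i\<in>I. smul (c i) (x i)) = (if n \<in> I then c n else 0)"
  using assms by (simp add: coord_sum if_distrib[of "\<lambda>t. _ * t"] cong: if_cong)

lemma mem_supp: "n \<in> spt f \<longleftrightarrow> xs n f \<noteq> 0"
  by (simp add: supp_def)

lemma zero_finite_support: "0 \<in> finite_support smul x"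
  by (simp add: finite_support_def supp_def)

lemma add_basis_finite_support:
  assumes "y \<in> finite_support smul x"
  shows "y + smul c (x k) \<in> finite_support smul x"
proof -
  have "spt (y + smul c (x k)) \<subseteq> insert k (spt y)"
    by (auto simp: mem_supp split: if_splits)
  then show ?thesis
    using assms finite_subset by (auto simp: finite_support_def)
qed

lemma smul_finite_support:
  assumes "y \<in> finite_support smul x"
  shows "smul c y \<in> finite_support smul x"
proof -
  have "spt (smul c y) \<subseteq> spt y"
    by (auto simp: mem_supp)
  then show ?thesis
    using assms finite_subset by (auto simp: finite_support_def)
qed

text \<open>The coordinates of \<open>f\<close> are bounded by a multiple of \<open>\<parallel>f\<parallel>\<close>, so the supremum is a true one.\<close>

lemma coord_le_of_coord_sup:
  assumes "coord_sup smul x f \<le> 1"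
  shows "norm (xs n f) \<le> 1"
proof (cases "n \<in> spt f")
  case True
  then have "f \<noteq> 0" by (auto simp: mem_supp)
  obtain c where c: "\<And>n. onorm (xs n) \<le> c"
    using basis unfolding semi_normalized_markushevich_basis_def by blast
  have "norm (xs m f) \<le> c * norm f" for m
    using onorm[OF bounded_linear_coord, of m f] c[of m]
    by (meson mult_right_mono norm_ge_zero order_trans)
  then have "bdd_above ((\<lambda>m. norm (xs m f)) ` spt f)"
    by (auto simp: bdd_above_def)
  then have "norm (xs n f) \<le> (SUP m\<in>spt f. norm (xs m f))"
    using True by (rule cSUP_upper[rotated])
  with assms \<open>f \<noteq> 0\<close> show ?thesis
    by (simp add: coord_sup_def)
next
  case False
  then show ?thesis by (simp add: mem_supp)
qed

text \<open>
  A nonzero vector must be seen by some coordinate, since the supremum of the empty set of reals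
  is an unspecified number.
\<close>

lemma coord_sup_le:
  assumes "\<And>n. norm (xs n f) \<le> 1" and "f = 0 \<or> spt f \<noteq> {}"
  shows "coord_sup smul x f \<le> 1"
  using assms by (auto simp: coord_sup_def intro!: cSUP_least)

lemma span_expansion:
  assumes "g \<in> span (range x)"
  shows "finite (spt g)" and "g = (\<Sum>i\<in>spt g. smul (xs i g) (x i))"
proof -
  have "\<exists>I c. finite I \<and> g = (\<Sum>i\<in>I. smul (c i) (x i))"
    using assms
  proof (induction rule: span_induct_alt)
    case base
    then show ?case by (intro exI[of _ "{}"]) auto
  next
    case (step a v y)
    then obtain j I c where v: "v = x j" and I: "finite I" "y = (\<Sum>i\<in>I. smul (c i) (x i))"
      by auto
    have "y = (\<Sum>i\<in>insert j I. smul (if i \<in> I then c i else 0) (x i))"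
      unfolding I(2) by (rule sum.mono_neutral_cong_left) (use I(1) in auto)
    moreover have "smul a v = (\<Sum>i\<in>insert j I. smul (if i = j then a else 0) (x i))"
      using I(1) by (simp add: v if_distrib[of "\<lambda>t. smul t _"] sum.delta cong: if_cong)
    ultimately have "smul a v + y =
        (\<Sum>i\<in>insert j I. smul ((if i = j then a else 0) + (if i \<in> I then c i else 0)) (x i))"
      by (simp add: scale_left_distrib sum.distrib)
    then show ?case using I(1) by (intro exI[of _ "insert j I"]) auto
  qed
  then obtain I c where I: "finite I" "g = (\<Sum>i\<in>I. smul (c i) (x i))" by blast
  have coef: "xs n g = (if n \<in> I then c n else 0)" for n
    using I by (simp add: coord_sum_basis)
  have sub: "spt g \<subseteq> I" by (auto simp: mem_supp coef split: if_splits)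
  then show "finite (spt g)" using I(1) finite_subset by blast
  have "(\<Sum>i\<in>spt g. smul (xs i g) (x i)) = (\<Sum>i\<in>I. smul (c i) (x i))"
    by (rule sum.mono_neutral_cong_left) (use I(1) sub in \<open>auto simp: mem_supp coef\<close>)
  then show "g = (\<Sum>i\<in>spt g. smul (xs i g) (x i))" using I(2) by simp
qed

lemma span_zero_iff:
  assumes "g \<in> span (range x)"
  shows "g = 0 \<longleftrightarrow> spt g = {}"
  using span_expansion(2)[OF assms] by (auto simp: mem_supp)

section \<open>The exchange inequality\<close>

definition exchange :: bool where
  "exchange \<longleftrightarrow> (\<forall>f. \<forall>y \<in> finite_support smul x. \<forall>n k. \<forall>\<epsilon> \<eta>.
       n \<noteq> k \<longrightarrow>
       coord_sup smul x f \<le> 1 \<longrightarrow>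
       spt f \<inter> spt y = {} \<longrightarrow>
       spt (f + y) \<inter> {n, k} = {} \<longrightarrow>
       norm \<epsilon> = 1 \<longrightarrow> norm \<eta> = 1 \<longrightarrow>
       norm (f + smul \<epsilon> (x n)) \<le> norm (f + smul \<eta> (x k) + y))"

lemma exchangeD:
  assumes exchange and "y \<in> finite_support smul x" and "n \<noteq> k" and "coord_sup smul x f \<le> 1"
    and "\<And>j. xs j f = 0 \<or> xs j y = 0"
    and "xs n f = 0" "xs n y = 0" "xs k f = 0" "xs k y = 0"
    and "norm \<epsilon> = 1" "norm \<eta> = 1"
  shows "norm (f + smul \<epsilon> (x n)) \<le> norm (f + smul \<eta> (x k) + y)"
proof -
  have "spt f \<inter> spt y = {}"
    unfolding disjoint_iff mem_supp using assms(5) by blast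
  moreover have "spt (f + y) \<inter> {n, k} = {}"
    using assms(6-9) by (auto simp: mem_supp)
  ultimately show ?thesis
    using assms(1-4,10,11) unfolding exchange_def by blast
qed

text \<open>
  Disjointness of the supports of \<open>f\<close> and \<open>y\<close> means that nothing cancels in \<open>f + y\<close>, so an index
  outside \<open>supp (f + y)\<close> lies outside both supports.
\<close>

lemma not_mem_supp_add:
  assumes "spt f \<inter> spt y = {}" and "n \<notin> spt (f + y)"
  shows "xs n f = 0" and "xs n y = 0"
proof -
  have "xs n f = 0 \<or> xs n y = 0" using assms(1) by (auto simp: mem_supp)
  then show "xs n f = 0" and "xs n y = 0" using assms(2) by (auto simp: mem_supp)
qed

lemma exchange_of_Q_star:
  assumes "property_Q_star_1 smul x"
  shows exchange
  unfolding exchange_def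
proof (intro allI ballI impI)
  fix f y n k and \<epsilon> \<eta> :: 'f
  assume y: "y \<in> finite_support smul x" and nk: "n \<noteq> k" and f: "coord_sup smul x f \<le> 1"
    and disj: "spt f \<inter> spt y = {}" and out: "spt (f + y) \<inter> {n, k} = {}"
    and unit: "norm \<epsilon> = 1" "norm \<eta> = 1"
  define z where "z = y + smul \<eta> (x k)"
  define B where "B = {m \<in> spt z. norm (xs m z) = 1}"
  have z: "z \<in> finite_support smul x"
    unfolding z_def using y by (rule add_basis_finite_support)
  have n0: "xs n f = 0" "xs n y = 0" and k0: "xs k f = 0" "xs k y = 0"
    using not_mem_supp_add[OF disj] out by auto
  have B: "finite B"
    using z by (simp add: B_def finite_support_def)
  have "\<eta> \<noteq> 0" using unit(2) by auto
  then have "k \<in> B" using k0 unit by (simp add: B_def z_def mem_supp)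
  then have card: "card {n} \<le> card B"
    using B by (simp add: Suc_le_eq card_gt_0_iff) blast
  have disj': "spt f \<inter> spt z = {}"
    using disj k0 by (auto simp: z_def mem_supp disjoint_iff)
  have out': "spt (f + z) \<inter> {n} = {}"
    using n0 nk by (auto simp: z_def mem_supp)
  have "norm (f + signed_indicator smul x (\<lambda>_. \<epsilon>) {n}) \<le> norm (f + z)"
    using assms[unfolded property_Q_star_1_def Let_def, rule_format, OF z f _ B[unfolded B_def]
        card[unfolded B_def] disj' out'] unit(1) by auto
  then show "norm (f + smul \<epsilon> (x n)) \<le> norm (f + smul \<eta> (x k) + y)"
    by (simp add: signed_indicator_def z_def algebra_simps)
qed

section \<open>Suppression of finitely many coordinates\<close>

text \<open>
  The exchange inequality needs a unimodular coefficient to work with. Dividing by the largest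
  coefficient produces one inside \<open>g\<close>, which is why \<open>y\<close> may be arbitrary; the index \<open>n\<close> exists
  because both supports are finite.
\<close>

lemma norm_le_add_of_span:
  assumes exchange and g: "g \<in> span (range x)" and y: "y \<in> finite_support smul x"
    and disj: "\<And>j. xs j g = 0 \<or> xs j y = 0"
  shows "norm g \<le> norm (g + y)"
proof (cases "g = 0")
  case False
  have fin: "finite (spt g)" "finite (spt y)"
    using span_expansion(1)[OF g] y by (auto simp: finite_support_def)
  have ne: "spt g \<noteq> {}"
    using False span_zero_iff[OF g] by simp
  define M where "M = Max ((\<lambda>j. norm (xs j g)) ` spt g)"
  have "M \<in> (\<lambda>j. norm (xs j g)) ` spt g"
    unfolding M_def using fin ne by (intro Max_in) auto
  then obtain k where k: "k \<in> spt g" "M = norm (xs k g)" by auto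
  then have M: "M > 0" by (simp add: mem_supp)
  have le_M: "norm (xs j g) \<le> M" for j
  proof (cases "j \<in> spt g")
    case True
    then show ?thesis unfolding M_def using fin by (intro Max_ge) auto
  next
    case False
    then show ?thesis using M by (simp add: mem_supp)
  qed
  define s :: 'f where "s = of_real (inverse M)"
  have s: "s \<noteq> 0" "norm s = inverse M" using M by (auto simp: s_def norm_inverse)
  define \<eta> where "\<eta> = s * xs k g"
  define h where "h = smul s g - smul \<eta> (x k)"
  have \<eta>: "norm \<eta> = 1"
    using k M by (simp add: \<eta>_def norm_mult s)
  have h_coord: "xs j h = (if j = k then 0 else s * xs j g)" for j
    by (simp add: h_def \<eta>_def)
  have "h \<in> span (range x)"
    unfolding h_def by (intro span_diff span_scale g span_base) auto
  moreover have "norm (xs j h) \<le> 1" for j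
    using le_M[of j] M by (simp add: h_coord norm_mult s field_simps)
  ultimately have h: "coord_sup smul x h \<le> 1"
    using span_zero_iff by (intro coord_sup_le) auto
  obtain n where n: "n \<notin> insert k (spt g \<union> spt y)"
    using fin ex_new_if_finite[of "insert k (spt g \<union> spt y)"] by auto
  then have n0: "n \<noteq> k" "xs n g = 0" "xs n y = 0"
    by (auto simp: mem_supp)
  have ky: "xs k y = 0"
    using disj[of k] k by (simp add: mem_supp)
  have "norm (h + smul \<eta> (x k)) \<le> norm (h + smul 1 (x n) + 0)"
    using n0 \<eta> by (intro exchangeD assms(1) zero_finite_support h) (auto simp: h_coord)
  also have "\<dots> \<le> norm (h + smul \<eta> (x k) + smul s y)"
  proof -
    have "xs j h = 0 \<or> xs j (smul s y) = 0" for j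
      using disj[of j] by (auto simp: h_coord)
    then have "norm (h + smul 1 (x n)) \<le> norm (h + smul \<eta> (x k) + smul s y)"
      using n0 \<eta> ky by (intro exchangeD assms(1) smul_finite_support y h) (auto simp: h_coord)
    then show ?thesis by simp
  qed
  finally have "norm (smul s g) \<le> norm (smul s (g + y))"
    by (simp add: h_def scale_right_distrib)
  then show ?thesis
    using M by (simp add: norm_smul s)
qed simp

text \<open>
  Erasing the coordinates in \<open>supp y\<close> turns the support condition on \<open>f\<close> into a statement
  about all vectors, whose solutions form a closed set; density of the span applies to it.
\<close>

lemma norm_le_add_of_disjoint_supp:
  assumes exchange and y: "y \<in> finite_support smul x" and disj: "spt f \<inter> spt y = {}"
  shows "norm f \<le> norm (f + y)"
proof -
  define P where "P v = v - (\<Sum>j\<in>spt y. smul (xs j v) (x j))" for v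
  have fin: "finite (spt y)" using y by (simp add: finite_support_def)
  (* Multiplication by real scalars is the restriction of smul, so c \<mapsto> c x\<^sub>j is real-linear. *)
  have cont_smul: "continuous_on UNIV (\<lambda>c. smul c (x j))" for j
  proof (rule linear_continuous_on)
    show "bounded_linear (\<lambda>c. smul c (x j))"
    proof (rule bounded_linear_intro)
      fix r c
      have "smul (r *\<^sub>R c) (x j) = smul (of_real r * c) (x j)"
        by (simp add: scaleR_conv_of_real)
      also have "\<dots> = r *\<^sub>R smul c (x j)"
        by (simp only: scale_scale[symmetric] smul_of_real)
      finally show "smul (r *\<^sub>R c) (x j) = r *\<^sub>R smul c (x j)" .
    qed (auto simp: scale_left_distrib norm_smul)
  qed
  have contP: "continuous_on UNIV P"
    unfolding P_def
    by (intro continuous_intros continuous_on_compose2[OF cont_smul]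
        linear_continuous_on bounded_linear_coord) auto
  have "closed {v. norm (P v) \<le> norm (P v + y)}"
    using contP by (intro closed_Collect_le continuous_intros)
  moreover have "span (range x) \<subseteq> {v. norm (P v) \<le> norm (P v + y)}"
  proof
    fix g assume g: "g \<in> span (range x)"
    have "P g \<in> span (range x)"
      unfolding P_def by (intro span_diff g span_sum span_scale span_base) auto
    moreover have "xs j (P g) = 0 \<or> xs j y = 0" for j
      using fin by (auto simp: P_def coord_sum_basis mem_supp)
    ultimately show "g \<in> {v. norm (P v) \<le> norm (P v + y)}"
      using norm_le_add_of_span[OF assms(1) _ y] by blast
  qed
  moreover have "closure (span (range x)) = UNIV"
    using basis by (simp add: semi_normalized_markushevich_basis_def)
  ultimately have "norm (P f) \<le> norm (P f + y)"
    using closure_minimal by blast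
  moreover have "P f = f"
    using disj by (auto simp: P_def mem_supp disjoint_iff intro!: sum.neutral)
  ultimately show ?thesis by simp
qed

section \<open>Trading indices\<close>

text \<open>
  One index \<open>k\<close> of \<open>B\<close> is used up for each element of \<open>A\<close>. The vector \<open>f\<close> varies in the induction
  because it absorbs \<open>x\<^sub>k\<^sup>*(y) x\<^sub>k\<close>, which keeps its coefficients bounded by one.
\<close>

lemma indicator_le_of_exchange:
  assumes exchange
    and "finite A" and "y \<in> finite_support smul x" and "coord_sup smul x f \<le> 1"
    and "card A \<le> card {n \<in> spt y. norm (xs n y) = 1}"
    and "spt f \<inter> spt y = {}" and "\<And>n. n \<in> A \<Longrightarrow> xs n f = 0 \<and> xs n y = 0"
    and "\<And>n. n \<in> A \<Longrightarrow> norm (\<epsilon> n) = 1"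
  shows "norm (f + signed_indicator smul x \<epsilon> A) \<le> norm (f + y)"
  using assms(2-)
proof (induction A arbitrary: f y rule: finite_induct)
  case empty
  then show ?case
    using norm_le_add_of_disjoint_supp[OF assms(1)] by (simp add: signed_indicator_def)
next
  case (insert n A)
  let ?B = "\<lambda>y. {n \<in> spt y. norm (xs n y) = 1}"
  have finB: "finite (?B y)" using insert.prems(1) by (simp add: finite_support_def)
  have "?B y \<noteq> {}"
    using insert.prems(3) insert.hyps by (intro notI) simp
  then obtain k where k: "k \<in> spt y" "norm (xs k y) = 1" by blast
  define \<eta> where "\<eta> = xs k y"
  define y' where "y' = y - smul \<eta> (x k)"
  define f' where "f' = f + smul \<eta> (x k)"
  define u where "u = f + signed_indicator smul x \<epsilon> A"
  have kf: "xs k f = 0" using insert.prems(4) k by (auto simp: mem_supp)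
  have kA: "k \<notin> insert n A" using k insert.prems(5)[of k] by (auto simp: mem_supp)
  have n0: "xs n f = 0" using insert.prems(5) by auto
  have y'_coord: "xs j y' = (if j = k then 0 else xs j y)" for j
    by (simp add: y'_def \<eta>_def)
  have f'_coord: "xs j f' = (if j = k then \<eta> else xs j f)" for j
    using kf by (simp add: f'_def)
  have u_coord: "xs j u = (if j \<in> A then \<epsilon> j else xs j f)" for j
    using insert.hyps(1) insert.prems(5)[of j]
    by (simp add: u_def signed_indicator_def coord_sum_basis)
  have u: "coord_sup smul x u \<le> 1"
  proof (cases "A = {}")
    case True
    then show ?thesis using insert.prems(2) by (simp add: u_def signed_indicator_def)
  next
    case False
    then obtain j where "j \<in> A" by blast
    moreover have "\<epsilon> j \<noteq> 0" using insert.prems(6)[of j] \<open>j \<in> A\<close> by auto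
    ultimately have "j \<in> spt u" by (simp add: mem_supp u_coord)
    then show ?thesis
      using insert.prems(6) coord_le_of_coord_sup[OF insert.prems(2)]
      by (intro coord_sup_le) (auto simp: u_coord)
  qed
  have f': "coord_sup smul x f' \<le> 1"
  proof (rule coord_sup_le)
    show "norm (xs j f') \<le> 1" for j
      using coord_le_of_coord_sup[OF insert.prems(2)] k by (simp add: f'_coord \<eta>_def)
    have "k \<in> spt f'" using k by (simp add: mem_supp f'_coord \<eta>_def)
    then show "f' = 0 \<or> spt f' \<noteq> {}" by blast
  qed
  have y': "y' \<in> finite_support smul x"
    using add_basis_finite_support[OF insert.prems(1), of "- \<eta>" k] by (simp add: y'_def)
  have "?B y' = ?B y - {k}" by (auto simp: mem_supp y'_coord split: if_splits)
  then have card: "card A \<le> card (?B y')"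
    using insert.prems(3) insert.hyps finB k by simp
  have disj: "spt f' \<inter> spt y' = {}"
    using insert.prems(4) by (auto simp: mem_supp f'_coord y'_coord disjoint_iff)
  have "norm (u + smul (\<epsilon> n) (x n)) \<le> norm (u + smul \<eta> (x k) + 0)"
    using kA kf n0 insert.hyps insert.prems(6)[of n] k
    by (intro exchangeD assms(1) zero_finite_support u) (auto simp: u_coord \<eta>_def)
  also have "u + smul \<eta> (x k) + 0 = f' + signed_indicator smul x \<epsilon> A"
    by (simp add: u_def f'_def)
  also have "norm \<dots> \<le> norm (f' + y')"
    using insert.prems(5,6) kA
    by (intro insert.IH y' f' card disj) (auto simp: f'_coord y'_coord)
  also have "f' + y' = f + y"
    by (simp add: f'_def y'_def)
  also have "u + smul (\<epsilon> n) (x n) = f + signed_indicator smul x \<epsilon> (insert n A)"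
    using insert.hyps by (simp add: u_def signed_indicator_def)
  finally show ?case .
qed

lemma Q_star_of_exchange:
  assumes exchange
  shows "property_Q_star_1 smul x"
  unfolding property_Q_star_1_def Let_def
proof (intro allI ballI impI)
  fix f y A and \<epsilon> :: "nat \<Rightarrow> 'f"
  assume y: "y \<in> finite_support smul x" and f: "coord_sup smul x f \<le> 1" and A: "finite A"
    and card: "card A \<le> card {n \<in> spt y. norm (xs n y) = 1}"
    and disj: "spt f \<inter> spt y = {}" and out: "spt (f + y) \<inter> A = {}"
    and unit: "\<forall>n\<in>A. norm (\<epsilon> n) = 1"
  have "xs n f = 0 \<and> xs n y = 0" if "n \<in> A" for n
    using not_mem_supp_add[OF disj, of n] out that by blast
  then show "norm (f + signed_indicator smul x \<epsilon> A) \<le> norm (f + y)"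
    using indicator_le_of_exchange[OF assms A y f card disj] unit by blast
qed

end

theorem theorem3p1:
  fixes smul :: "'f::real_normed_field \<Rightarrow> 'a::banach \<Rightarrow> 'a"
    and x :: "nat \<Rightarrow> 'a"
  assumes "banach_over smul"
    and "semi_normalized_markushevich_basis smul x"
  shows "property_Q_star_1 smul x \<longleftrightarrow>
    (\<forall>f. \<forall>y \<in> finite_support smul x. \<forall>n k. \<forall>\<epsilon> \<eta> :: 'f.
       n \<noteq> k \<longrightarrow>
       coord_sup smul x f \<le> 1 \<longrightarrow>
       supp smul x f \<inter> supp smul x y = {} \<longrightarrow>
       supp smul x (f + y) \<inter> {n, k} = {} \<longrightarrow>
       norm \<epsilon> = 1 \<longrightarrow> norm \<eta> = 1 \<longrightarrow>
       norm (f + smul \<epsilon> (x n)) \<le> norm (f + smul \<eta> (x k) + y))"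
proof -
  interpret markushevich_basis smul x
    using assms by (simp add: markushevich_basis_def markushevich_basis_axioms_def)
  show ?thesis
    using exchange_of_Q_star Q_star_of_exchange unfolding exchange_def by blast
qed

end
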